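(* Let $G=(V,E)$ be a locally finite connected simple graph with Bernoulli bond percolation in which each edge $e\in E$ is open with probability $p_e\in[0,1]$, independently of the other edges. Let $a,b,c$ be distinct vertices of $G$, and assume the denominators below are nonzero. Then $$\mathbf{P}(a|b|c)+\mathbf{P}(a|b\cup a|c)^2\ \ge\ \frac{\mathbf{P}(a|b|c)^2}{\mathbf{P}(a|b\cup b|c)}+\frac{\mathbf{P}(a|b|c)^2}{\mathbf{P}(a|c\cup b|c)}.$$
   Context: A percolation configuration is an element of $\{0,1\}^E$ (1 = open, 0 = closed); $\mathbf{P}$ is the product measure in which edge $e$ is open with probability $p_e$. Clusters are the connected components of the subgraph of open edges. $a|b|c$ denotes the event that $a,b,c$ are in three different clusters. For vertices $u,v$, $u|v$ denotes the event that $u$ and $v$ are in two different clusters. $\cup$ denotes the union of events, so e.g. $a|b\cup a|c$ is the event that $a|b$ occurs or $a|c$ occurs. *)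

theory Defs
  imports "HOL-Probability.Probability"
begin

text \<open>
  A simple graph is given by its vertex set \<open>V\<close> and its edge set \<open>E\<close>, whose members are
  two-element subsets of \<open>V\<close>.
\<close>

definition simple_graph :: "'v set \<Rightarrow> 'v set set \<Rightarrow> bool" where
  "simple_graph V E \<longleftrightarrow> (\<forall>e\<in>E. e \<subseteq> V \<and> card e = 2)"

definition locally_finite_graph :: "'v set \<Rightarrow> 'v set set \<Rightarrow> bool" where
  "locally_finite_graph V E \<longleftrightarrow> (\<forall>v\<in>V. finite {e \<in> E. v \<in> e})"

definition adjacency :: "'v set set \<Rightarrow> ('v \<times> 'v) set" where
  "adjacency F = {(u, v). {u, v} \<in> F}"

definition component :: "'v set set \<Rightarrow> 'v \<Rightarrow> 'v set" where
  "component F v = {w. (v, w) \<in> (adjacency F)\<^sup>*}"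

definition connected_graph :: "'v set \<Rightarrow> 'v set set \<Rightarrow> bool" where
  "connected_graph V E \<longleftrightarrow> V \<noteq> {} \<and> (\<forall>u\<in>V. \<forall>v\<in>V. v \<in> component E u)"

text \<open>
  Configurations are the extensional functions from \<open>E\<close> to \<open>bool\<close>, with \<open>True\<close> for open; these are
  the points of the product space below. As \<open>bernoulli_pmf\<close> clamps its parameter to the unit
  interval, \<open>p e\<close> is the probability that \<open>e\<close> is open only if it lies in that interval.
\<close>

definition configurations :: "'v set set \<Rightarrow> ('v set \<Rightarrow> bool) set" where
  "configurations E = E \<rightarrow>\<^sub>E UNIV"

definition percolation :: "'v set set \<Rightarrow> ('v set \<Rightarrow> real) \<Rightarrow> ('v set \<Rightarrow> bool) measure" where
  "percolation E p = (\<Pi>\<^sub>M e\<in>E. measure_pmf (bernoulli_pmf (p e)))"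

definition cluster :: "'v set set \<Rightarrow> ('v set \<Rightarrow> bool) \<Rightarrow> 'v \<Rightarrow> 'v set" where
  "cluster E \<omega> v = component {e \<in> E. \<omega> e} v"

definition separated :: "'v set set \<Rightarrow> 'v \<Rightarrow> 'v \<Rightarrow> ('v set \<Rightarrow> bool) set" where
  "separated E u v = {\<omega> \<in> configurations E. cluster E \<omega> u \<noteq> cluster E \<omega> v}"

definition separated3 :: "'v set set \<Rightarrow> 'v \<Rightarrow> 'v \<Rightarrow> 'v \<Rightarrow> ('v set \<Rightarrow> bool) set" where
  "separated3 E u v w =
     {\<omega> \<in> configurations E. cluster E \<omega> u \<noteq> cluster E \<omega> v \<and>
        cluster E \<omega> u \<noteq> cluster E \<omega> w \<and> cluster E \<omega> v \<noteq> cluster E \<omega> w}"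

end

theory Submission
  imports Defs
begin

text \<open>
  The three unions in the statement are one and the same event, "\<open>a\<close>, \<open>b\<close>, \<open>c\<close> do not all lie
  in one cluster", because being in the same cluster is transitive. Write \<open>t\<close> for the probability
  that all three share a cluster, \<open>s = P(a|b|c)\<close>, and \<open>x = 1 - t - s\<close> for the probability that
  exactly two of them do. With \<open>q = 1 - t = s + x\<close> the claim is \<open>s + q\<^sup>2 \<ge> 2 s\<^sup>2 / q\<close>.

  Everything follows from the inequality \<open>t * s \<le> x\<close>. It gives
  \<open>t * q = t * s + t * x \<le> 2 * x\<close>, that is \<open>2 * s \<le> q * (1 + q)\<close>, and with \<open>s \<le> q\<close> this yields
  \<open>2 * s\<^sup>2 \<le> s * q + s * q\<^sup>2 \<le> (s + q\<^sup>2) * q\<close>.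

  The inequality \<open>t * s \<le> x\<close> is proved by exchanging edges between two independent configurations
  \<open>F\<close> and \<open>G\<close>, where \<open>F\<close> joins \<open>a\<close>, \<open>b\<close>, \<open>c\<close> and \<open>G\<close> separates them. Let \<open>A\<close> be the
  cluster of \<open>a\<close> in \<open>G\<close>, so \<open>b\<close> and \<open>c\<close> are outside \<open>A\<close>; for \<open>u = b, c\<close> let \<open>K\<close> be the set of
  vertices that \<open>F\<close> joins to \<open>u\<close> without touching \<open>A\<close>, and exchange the states of \<open>F\<close> and \<open>G\<close>
  on the edges between \<open>K\<close> and \<open>A\<close>. These edges are closed in \<open>G\<close>, so the new first configuration
  has \<open>K\<close> as the cluster of \<open>u\<close>. Two points make this work.

  First, the exchange preserves the product weight and can be undone: \<open>K\<close> is read off the new first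
  configuration, and then \<open>A\<close> is what the new second configuration joins to \<open>a\<close> without touching
  \<open>K\<close> (\<open>cut_eq_recovered_cut\<close>). Hence such an exchange does not increase probabilities
  (\<open>exchange_weight_bound\<close>).

  Second, one of the two exchanges leaves exactly two of \<open>a\<close>, \<open>b\<close>, \<open>c\<close> together
  (\<open>one_cut_leaves_a_pair\<close>): if the set for \<open>c\<close> contains \<open>b\<close>, then cutting it off leaves \<open>b\<close> and
  \<open>c\<close> together without \<open>a\<close>; otherwise follow a path of \<open>F\<close> from \<open>a\<close> up to the first of the two
  sets that it meets, and cut off the other set.

  This argument sums over configurations of finitely many edges. The general case follows by
  exhausting the graph with balls around \<open>a\<close>, because "all three together" and "at least two
  together" are increasing limits of the same events for finite edge sets.
\<close>

section \<open>Clusters\<close>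

lemma component_refl: "v \<in> component F v"
  by (simp add: component_def)

lemma component_step: "x \<in> component F v \<Longrightarrow> {x, y} \<in> F \<Longrightarrow> y \<in> component F v"
  unfolding component_def adjacency_def by (auto intro: rtrancl_into_rtrancl)

lemma component_least:
  assumes "v \<in> X" and "\<And>x y. x \<in> X \<Longrightarrow> {x, y} \<in> F \<Longrightarrow> y \<in> X"
  shows "component F v \<subseteq> X"
proof
  fix w assume "w \<in> component F v"
  then have "(v, w) \<in> (adjacency F)\<^sup>*" by (simp add: component_def)
  then show "w \<in> X"
    by (induction rule: rtrancl_induct) (use assms in \<open>auto simp: adjacency_def\<close>)
qed

lemma component_mono: "F \<subseteq> G \<Longrightarrow> component F v \<subseteq> component G v"
  by (rule component_least) (auto intro: component_refl component_step)

lemma component_sym: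
  assumes "w \<in> component F v"
  shows "v \<in> component F w"
proof -
  have "sym (adjacency F)" by (auto simp: sym_def adjacency_def insert_commute)
  then show ?thesis using assms by (auto simp: component_def dest: sym_rtrancl symD)
qed

lemma component_trans: "v \<in> component F u \<Longrightarrow> w \<in> component F v \<Longrightarrow> w \<in> component F u"
  unfolding component_def by auto

lemma component_eq_iff: "component F u = component F v \<longleftrightarrow> v \<in> component F u"
  using component_refl component_sym component_trans by (metis subsetI subset_antisym)

definition all_joined :: "'v \<Rightarrow> 'v \<Rightarrow> 'v \<Rightarrow> 'v set set \<Rightarrow> bool" where
  "all_joined a b c F \<longleftrightarrow> b \<in> component F a \<and> c \<in> component F a"

definition some_joined :: "'v \<Rightarrow> 'v \<Rightarrow> 'v \<Rightarrow> 'v set set \<Rightarrow> bool" where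
  "some_joined a b c F \<longleftrightarrow>
     b \<in> component F a \<or> c \<in> component F a \<or> c \<in> component F b"

section \<open>Exchanging a cut between two configurations\<close>

definition avoiding :: "'v set set \<Rightarrow> 'v set \<Rightarrow> 'v set set" where
  "avoiding F A = {e \<in> F. e \<inter> A = {}}"

definition between :: "'v set set \<Rightarrow> 'v set \<Rightarrow> 'v set \<Rightarrow> 'v set set" where
  "between E K A = {e \<in> E. e \<inter> K \<noteq> {} \<and> e \<inter> A \<noteq> {}}"

definition exchange :: "'e set \<Rightarrow> 'e set \<times> 'e set \<Rightarrow> 'e set \<times> 'e set" where
  "exchange S = (\<lambda>(F, G). ((F - S) \<union> (G \<inter> S), (G - S) \<union> (F \<inter> S)))"

definition cut :: "'v set set \<Rightarrow> 'v \<Rightarrow> 'v \<Rightarrow> 'v set set \<times> 'v set set \<Rightarrow> 'v set set" where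
  "cut E a u = (\<lambda>(F, G).
     between E (component (avoiding F (component G a)) u) (component G a))"

text \<open>
  The formula that finds the cut again after the exchange: the two clusters are explored in the
  opposite order, and the one explored first is not restricted.
\<close>

definition recovered_cut :: "'v set set \<Rightarrow> 'v \<Rightarrow> 'v \<Rightarrow> 'v set set \<times> 'v set set \<Rightarrow> 'v set set" where
  "recovered_cut E a u = (\<lambda>(X, Y).
     between E (component X u) (component (avoiding Y (component X u)) a))"

lemma exchange_exchange: "exchange S (exchange S z) = z"
  by (cases z) (auto simp: exchange_def)

lemma component_avoiding_disjoint: "u \<notin> A \<Longrightarrow> component (avoiding F A) u \<inter> A = {}"
  using component_least[of u "- A" "avoiding F A"] by (auto simp: avoiding_def)

lemma component_minus_cut:
  assumes "u \<notin> A" and "F \<subseteq> E"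
  defines "K \<equiv> component (avoiding F A) u"
  shows "component (F - between E K A) u = K"
proof
  have dis: "K \<inter> A = {}"
    unfolding K_def using assms(1) by (rule component_avoiding_disjoint)
  show "component (F - between E K A) u \<subseteq> K"
  proof (rule component_least)
    show "u \<in> K" by (simp add: K_def component_refl)
    fix x y assume x: "x \<in> K" and e: "{x, y} \<in> F - between E K A"
    then have "y \<notin> A" using \<open>F \<subseteq> E\<close> by (auto simp: between_def)
    then have "{x, y} \<in> avoiding F A" using x e dis by (auto simp: avoiding_def)
    then show "y \<in> K" using x unfolding K_def by (rule component_step[rotated])
  qed
  show "K \<subseteq> component (F - between E K A) u"
    unfolding K_def by (rule component_mono) (auto simp: avoiding_def between_def)
qed

text \<open>
  The second configuration has no open edge leaving the cluster of \<open>a\<close>, so it has none in the cut,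
  and the exchange only moves edges from the first configuration to the second.
\<close>

lemma exchange_cut:
  fixes E F G :: "'v set set"
  assumes card: "\<And>e. e \<in> E \<Longrightarrow> card e = 2" and G: "G \<subseteq> E" and u: "u \<notin> component G a"
  defines "S \<equiv> cut E a u (F, G)"
  shows "exchange S (F, G) = (F - S, G \<union> (F \<inter> S))"
proof -
  define A where "A = component G a"
  define K where "K = component (avoiding F A) u"
  have dis: "K \<inter> A = {}"
    unfolding K_def using u by (intro component_avoiding_disjoint) (simp add: A_def)
  have "e \<notin> G" if "e \<in> S" for e
  proof
    assume "e \<in> G"
    from \<open>e \<in> S\<close> obtain x y where xy: "x \<in> e" "x \<in> A" "y \<in> e" "y \<in> K"
      by (auto simp: S_def cut_def between_def A_def K_def)
    with dis have "x \<noteq> y" by auto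
    with xy card[of e] \<open>e \<in> G\<close> G have "e = {x, y}"
      by (auto simp: card_2_iff)
    with \<open>e \<in> G\<close> \<open>x \<in> A\<close> have "y \<in> A" unfolding A_def by (auto intro: component_step)
    with dis \<open>y \<in> K\<close> show False by auto
  qed
  then show ?thesis by (auto simp: exchange_def)
qed

lemma cut_eq_recovered_cut:
  assumes card: "\<And>e. e \<in> E \<Longrightarrow> card e = 2" and F: "F \<subseteq> E" and G: "G \<subseteq> E"
    and u: "u \<notin> component G a"
  shows "recovered_cut E a u (exchange (cut E a u (F, G)) (F, G)) = cut E a u (F, G)"
proof -
  define A where "A = component G a"
  define K where "K = component (avoiding F A) u"
  define S where "S = between E K A"
  have S: "S = cut E a u (F, G)" by (simp add: S_def cut_def A_def K_def)
  have uA: "u \<notin> A" using u by (simp add: A_def)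
  have dis: "K \<inter> A = {}" unfolding K_def using uA by (rule component_avoiding_disjoint)
  have K: "component (F - S) u = K"
    unfolding S_def K_def by (rule component_minus_cut[OF uA F])
  \<comment> \<open>Every edge of the cut touches \<open>K\<close>, so the edges received from \<open>F\<close> do not matter here.\<close>
  have av: "avoiding (G \<union> (F \<inter> S)) K = avoiding G K"
    by (auto simp: avoiding_def S_def between_def)
  have "component (avoiding G K) a = A"
  proof
    show "component (avoiding G K) a \<subseteq> A"
      unfolding A_def by (rule component_mono) (auto simp: avoiding_def)
    have "A \<subseteq> component (avoiding G K) a \<inter> A"
      unfolding A_def
    proof (rule component_least)
      show "a \<in> component (avoiding G K) a \<inter> component G a" by (simp add: component_refl)
      fix x y assume x: "x \<in> component (avoiding G K) a \<inter> component G a" and e: "{x, y} \<in> G"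
      then have y: "y \<in> component G a" by (auto intro: component_step)
      then have "{x, y} \<in> avoiding G K" using x e dis by (auto simp: avoiding_def A_def)
      with x y show "y \<in> component (avoiding G K) a \<inter> component G a"
        by (auto intro: component_step)
    qed
    then show "A \<subseteq> component (avoiding G K) a" by auto
  qed
  then show ?thesis
    unfolding S[symmetric] using exchange_cut[OF card G u, of F] K av
    by (simp add: S[symmetric] recovered_cut_def S_def[symmetric])
qed

text \<open>
  Let \<open>K\<^sub>b\<close> and \<open>K\<^sub>c\<close> be the sets that \<open>F\<close> joins to \<open>b\<close> and \<open>c\<close> outside the cluster \<open>A\<close> of
  \<open>a\<close> in \<open>G\<close>. If they are disjoint, consider the first edge of an \<open>F\<close>-path from \<open>a\<close> to \<open>b\<close> that
  lies in one of the two cuts. It cannot lie in both, as it would have to touch the three disjoint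
  sets \<open>A\<close>, \<open>K\<^sub>b\<close>, \<open>K\<^sub>c\<close>. So if it lies in the cut of \<open>c\<close>, say, then deleting the cut of \<open>b\<close>
  leaves \<open>a\<close> joined to \<open>K\<^sub>c\<close> and hence to \<open>c\<close>, while \<open>b\<close> is cut off. If there is no such edge,
  the path survives the deletion of the cut of \<open>c\<close>.
\<close>

lemma one_cut_leaves_a_pair:
  assumes card: "\<And>e. e \<in> E \<Longrightarrow> card e = 2" and F: "F \<subseteq> E" and G: "G \<subseteq> E"
    and joined: "all_joined a b c F" and apart: "b \<notin> component G a" "c \<notin> component G a"
  defines "Fb \<equiv> F - cut E a b (F, G)" and "Fc \<equiv> F - cut E a c (F, G)"
  shows "(\<not> all_joined a b c Fc \<and> (b \<in> component Fc a \<or> c \<in> component Fc b)) \<or>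
         (\<not> all_joined a b c Fb \<and> c \<in> component Fb a)"
proof -
  define A where "A = component G a"
  define Kb where "Kb = component (avoiding F A) b"
  define Kc where "Kc = component (avoiding F A) c"
  define Sb where "Sb = between E Kb A"
  define Sc where "Sc = between E Kc A"
  have eqs: "Fb = F - Sb" "Fc = F - Sc"
    by (simp_all add: Fb_def Fc_def Sb_def Sc_def cut_def A_def Kb_def Kc_def)
  have aA: "a \<in> A" by (simp add: A_def component_refl)
  have bA: "b \<notin> A" and cA: "c \<notin> A" using apart by (simp_all add: A_def)
  have dis: "Kb \<inter> A = {}" "Kc \<inter> A = {}"
    unfolding Kb_def Kc_def using bA cA by (auto dest: component_avoiding_disjoint)
  have clb: "component Fb b = Kb"
    unfolding eqs Sb_def Kb_def by (rule component_minus_cut[OF bA F])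
  have clc: "component Fc c = Kc"
    unfolding eqs Sc_def Kc_def by (rule component_minus_cut[OF cA F])
  have not_ab: "b \<notin> component Fb a"
    using clb dis aA component_sym[of b Fb a] by auto
  have not_ac: "c \<notin> component Fc a"
    using clc dis aA component_sym[of c Fc a] by auto
  have sub: "avoiding F A \<subseteq> Fb" "avoiding F A \<subseteq> Fc"
    by (auto simp: eqs avoiding_def Sb_def Sc_def between_def)
  show ?thesis
  proof (cases "b \<in> Kc")
    case True
    then have "c \<in> component Fc b" using clc component_sym[of b Fc c] by simp
    with not_ac show ?thesis by (simp add: all_joined_def)
  next
    case False
    have "b \<in> Kc" if "x \<in> Kb" "x \<in> Kc" for x
      using that component_trans[OF _ component_sym] unfolding Kb_def Kc_def by metis
    with False have disK: "Kb \<inter> Kc = {}" by auto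
    have three: "e \<notin> Sc" if "e \<in> Sb" for e
    proof
      assume "e \<in> Sc"
      with that obtain x y z where xyz: "x \<in> e" "y \<in> e" "z \<in> e" "x \<in> Kb" "y \<in> Kc" "z \<in> A"
        by (auto simp: Sb_def Sc_def between_def)
      with dis disK have "x \<noteq> y" "x \<noteq> z" "y \<noteq> z" by auto
      moreover have "card e = 2" using that card by (auto simp: Sb_def between_def)
      ultimately show False using xyz by (auto simp: card_2_iff)
    qed
    \<comment> \<open>\<open>W\<close> is what an \<open>F\<close>-path from \<open>a\<close> reaches before it uses an edge of either cut.\<close>
    define W where "W = component (Fb \<inter> Fc) a"
    have Wb: "W \<subseteq> component Fb a" and Wc: "W \<subseteq> component Fc a"
      unfolding W_def by (auto intro!: component_mono)
    show ?thesis
    proof (cases "\<forall>x y. x \<in> W \<longrightarrow> {x, y} \<in> F \<longrightarrow> y \<in> W")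
      case True
      have "component F a \<subseteq> W"
        by (rule component_least) (use True in \<open>auto simp: W_def component_refl\<close>)
      then have "b \<in> component Fc a" using joined Wc by (auto simp: all_joined_def)
      with not_ac show ?thesis by (simp add: all_joined_def)
    next
      case False
      then obtain x y where x: "x \<in> W" and e: "{x, y} \<in> F" and y: "y \<notin> W" by blast
      have "{x, y} \<notin> Fb \<inter> Fc"
        using x y unfolding W_def by (auto intro: component_step)
      then consider "{x, y} \<in> Sb" "{x, y} \<in> Fc" | "{x, y} \<in> Sc" "{x, y} \<in> Fb"
        using e three by (auto simp: eqs)
      then show ?thesis
      proof cases
        case 1
        then have ya: "y \<in> component Fc a" using x Wc by (auto intro: component_step)
        obtain k where k: "k \<in> {x, y}" "k \<in> Kb" using 1 by (auto simp: Sb_def between_def)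
        have ka: "k \<in> component Fc a" using k(1) ya x Wc by auto
        have "k \<in> component Fc b"
          using k(2) component_mono[OF sub(2), of b] by (auto simp: Kb_def)
        then have "b \<in> component Fc a"
          using ka component_sym component_trans by metis
        with not_ac show ?thesis by (simp add: all_joined_def)
      next
        case 2
        then have ya: "y \<in> component Fb a" using x Wb by (auto intro: component_step)
        obtain k where k: "k \<in> {x, y}" "k \<in> Kc" using 2 by (auto simp: Sc_def between_def)
        have ka: "k \<in> component Fb a" using k(1) ya x Wb by auto
        have "k \<in> component Fb c"
          using k(2) component_mono[OF sub(1), of c] by (auto simp: Kc_def)
        then have "c \<in> component Fb a"
          using ka component_sym component_trans by metis
        with not_ab show ?thesis by (simp add: all_joined_def)
      qed
    qed
  qed
qed

section \<open>The inequality for finitely many edges\<close>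

definition weight :: "('e \<Rightarrow> bool \<Rightarrow> real) \<Rightarrow> 'e set \<Rightarrow> 'e set \<Rightarrow> real" where
  "weight h E F = (\<Prod>e\<in>E. h e (e \<in> F))"

definition weight_of :: "('e \<Rightarrow> bool \<Rightarrow> real) \<Rightarrow> 'e set \<Rightarrow> ('e set \<Rightarrow> bool) \<Rightarrow> real" where
  "weight_of h E Q = (\<Sum>F \<in> {F \<in> Pow E. Q F}. weight h E F)"

lemma weight_nonneg: "(\<And>e b. 0 \<le> h e b) \<Longrightarrow> 0 \<le> weight h E F"
  by (simp add: weight_def prod_nonneg)

lemma weight_exchange:
  "weight h E (fst (exchange S z)) * weight h E (snd (exchange S z)) =
   weight h E (fst z) * weight h E (snd z)"
proof (cases z)
  case (Pair F G)
  then show ?thesis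
    unfolding weight_def prod.distrib[symmetric]
  proof (intro prod.cong refl)
    fix e
    show "h e (e \<in> fst (exchange S z)) * h e (e \<in> snd (exchange S z)) =
        h e (e \<in> fst z) * h e (e \<in> snd z)"
      by (cases "e \<in> S") (simp_all add: Pair exchange_def)
  qed
qed

text \<open>
  On the pairs summed over here the exchange is injective, with the inverse given by
  \<open>recovered_cut\<close>, and its image lies in the product of \<open>Z\<close> with the set of all configurations.
\<close>

lemma exchange_weight_bound:
  assumes fin: "finite E" and card: "\<And>e. e \<in> E \<Longrightarrow> card e = 2" and h: "\<And>e b. 0 \<le> h e b"
  defines "w \<equiv> \<lambda>z. weight h E (fst z) * weight h E (snd z)"
  shows "(\<Sum>z \<in> {(F, G). F \<subseteq> E \<and> G \<subseteq> E \<and> u \<notin> component G a \<and> Z (F - cut E a u (F, G))}. w z)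
         \<le> weight_of h E Z * weight_of h E (\<lambda>_. True)"
proof -
  define D where
    "D = {(F, G). F \<subseteq> E \<and> G \<subseteq> E \<and> u \<notin> component G a \<and> Z (F - cut E a u (F, G))}"
  define \<phi> where "\<phi> z = exchange (cut E a u z) z" for z
  have "inj_on \<phi> D"
  proof (rule inj_on_inverseI)
    fix z assume "z \<in> D"
    then show "exchange (recovered_cut E a u (\<phi> z)) (\<phi> z) = z"
      using cut_eq_recovered_cut[OF card] by (auto simp: D_def \<phi>_def exchange_exchange)
  qed
  have into: "\<phi> ` D \<subseteq> {F \<in> Pow E. Z F} \<times> {G \<in> Pow E. True}"
  proof
    fix y assume "y \<in> \<phi> ` D"
    then obtain F G where FG: "(F, G) \<in> D" and y: "y = \<phi> (F, G)" by auto
    then have "y = (F - cut E a u (F, G), G \<union> (F \<inter> cut E a u (F, G)))"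
      using exchange_cut[OF card] by (auto simp: D_def \<phi>_def)
    with FG show "y \<in> {F \<in> Pow E. Z F} \<times> {G \<in> Pow E. True}" by (auto simp: D_def)
  qed
  have "(\<Sum>z\<in>D. w z) = (\<Sum>z\<in>D. w (\<phi> z))"
    by (simp add: w_def \<phi>_def weight_exchange)
  also have "\<dots> = (\<Sum>z\<in>\<phi> ` D. w z)"
    using \<open>inj_on \<phi> D\<close> by (simp add: sum.reindex)
  also have "\<dots> \<le> (\<Sum>z\<in>{F \<in> Pow E. Z F} \<times> {G \<in> Pow E. True}. w z)"
    using into fin by (intro sum_mono2) (auto simp: w_def weight_nonneg h)
  also have "\<dots> = weight_of h E Z * weight_of h E (\<lambda>_. True)"
    by (simp add: weight_of_def w_def sum_product sum.cartesian_product case_prod_beta)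
  finally show ?thesis by (simp add: D_def)
qed

text \<open>
  The last factor is the total weight; keeping it makes the inequality homogeneous, so that the
  weights need not be normalised.
\<close>

lemma joined_separated_weight_le:
  assumes fin: "finite E" and card: "\<And>e. e \<in> E \<Longrightarrow> card e = 2" and h: "\<And>e b. 0 \<le> h e b"
  shows "weight_of h E (all_joined a b c) * weight_of h E (\<lambda>F. \<not> some_joined a b c F)
         \<le> weight_of h E (\<lambda>F. some_joined a b c F \<and> \<not> all_joined a b c F) *
           weight_of h E (\<lambda>_. True)"
proof -
  define w where "w z = weight h E (fst z) * weight h E (snd z)" for z
  define Zc where "Zc F \<longleftrightarrow> \<not> all_joined a b c F \<and> (b \<in> component F a \<or> c \<in> component F b)" for F
  define Zb where "Zb F \<longleftrightarrow> \<not> all_joined a b c F \<and> c \<in> component F a" for F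
  define D where
    "D u Z = {(F, G). F \<subseteq> E \<and> G \<subseteq> E \<and> u \<notin> component G a \<and> Z (F - cut E a u (F, G))}" for u Z
  have finD: "finite (D u Z)" for u Z
    by (rule finite_subset[of _ "Pow E \<times> Pow E"]) (use fin in \<open>auto simp: D_def\<close>)
  have w0: "0 \<le> w z" for z by (simp add: w_def weight_nonneg h)
  have "weight_of h E (all_joined a b c) * weight_of h E (\<lambda>F. \<not> some_joined a b c F) =
      (\<Sum>z\<in>{F \<in> Pow E. all_joined a b c F} \<times> {G \<in> Pow E. \<not> some_joined a b c G}. w z)"
    by (simp add: weight_of_def w_def sum_product sum.cartesian_product case_prod_beta)
  also have "\<dots> \<le> (\<Sum>z\<in>D c Zc \<union> D b Zb. w z)"
  proof (intro sum_mono2)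
    show "{F \<in> Pow E. all_joined a b c F} \<times> {G \<in> Pow E. \<not> some_joined a b c G}
        \<subseteq> D c Zc \<union> D b Zb"
    proof (rule subsetI)
      fix z assume "z \<in> {F \<in> Pow E. all_joined a b c F} \<times> {G \<in> Pow E. \<not> some_joined a b c G}"
      then obtain F G where z: "z = (F, G)" and FG: "F \<subseteq> E" "G \<subseteq> E" "all_joined a b c F"
          "b \<notin> component G a" "c \<notin> component G a"
        by (auto simp: some_joined_def)
      from one_cut_leaves_a_pair[OF card this(2-6)] FG show "z \<in> D c Zc \<union> D b Zb"
        by (auto simp: z D_def Zc_def Zb_def)
    qed
  qed (use finD w0 in auto)
  also have "\<dots> \<le> (\<Sum>z\<in>D c Zc. w z) + (\<Sum>z\<in>D b Zb. w z)"
    using sum.union_inter[OF finD finD, of w c Zc b Zb] sum_nonneg[of "D c Zc \<inter> D b Zb" w] w0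
    by simp
  also have "\<dots> \<le> weight_of h E Zc * weight_of h E (\<lambda>_. True) +
      weight_of h E Zb * weight_of h E (\<lambda>_. True)"
    unfolding D_def w_def using exchange_weight_bound[OF fin card h] by (intro add_mono) auto
  also have "\<dots> = (weight_of h E Zc + weight_of h E Zb) * weight_of h E (\<lambda>_. True)"
    by (simp add: algebra_simps)
  also have "weight_of h E Zc + weight_of h E Zb =
      weight_of h E (\<lambda>F. some_joined a b c F \<and> \<not> all_joined a b c F)"
  proof -
    have tr: "all_joined a b c F"
      if "c \<in> component F a" "b \<in> component F a \<or> c \<in> component F b" for F
      using that component_sym component_trans unfolding all_joined_def by metis
    have "{F \<in> Pow E. some_joined a b c F \<and> \<not> all_joined a b c F} =
        {F \<in> Pow E. Zc F} \<union> {F \<in> Pow E. Zb F}"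
      by (auto simp: Zc_def Zb_def some_joined_def)
    moreover have "{F \<in> Pow E. Zc F} \<inter> {F \<in> Pow E. Zb F} = {}"
      using tr by (auto simp: Zc_def Zb_def)
    ultimately show ?thesis
      unfolding weight_of_def using fin by (simp add: sum.union_disjoint)
  qed
  finally show ?thesis .
qed

section \<open>Events that depend on finitely many edges\<close>

lemma product_prob_space_bernoulli: "product_prob_space (\<lambda>e. measure_pmf (bernoulli_pmf (p e)))"
  by (simp add: product_prob_space_def product_prob_space_axioms_def product_sigma_finite_def
      measure_pmf.prob_space_axioms measure_pmf.sigma_finite_measure_axioms)

lemma space_percolation: "space (percolation E p) = configurations E"
  by (simp add: percolation_def configurations_def space_PiM)

lemma prob_space_percolation: "prob_space (percolation E p)"
  unfolding percolation_def by (intro prob_space_PiM measure_pmf.prob_space_axioms)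

lemma
  assumes J: "J \<subseteq> E" "finite J"
  shows measurable_finite_event:
      "{\<omega> \<in> configurations E. Q {e \<in> J. \<omega> e}} \<in> sets (percolation E p)"
    and measure_finite_event:
      "measure (percolation E p) {\<omega> \<in> configurations E. Q {e \<in> J. \<omega> e}} =
       weight_of (\<lambda>e. pmf (bernoulli_pmf (p e))) J Q"
proof -
  interpret product_prob_space "\<lambda>e. measure_pmf (bernoulli_pmf (p e))" E
    by (rule product_prob_space_bernoulli)
  interpret perc: prob_space "percolation E p" by (rule prob_space_percolation)
  define cyl where "cyl F = {\<omega> \<in> configurations E. {e \<in> J. \<omega> e} = F}" for F
  have emb: "cyl F = prod_emb E (\<lambda>e. measure_pmf (bernoulli_pmf (p e))) J (\<Pi>\<^sub>E e\<in>J. {e \<in> F})"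
    if "F \<subseteq> J" for F
    using that J
    by (auto simp: cyl_def prod_emb_def configurations_def PiE_iff extensional_def restrict_def)
  have meas: "cyl F \<in> sets (percolation E p)" if "F \<subseteq> J" for F
    unfolding emb[OF that] percolation_def using J by (intro sets_PiM_I) auto
  have prob: "measure (percolation E p) (cyl F) = weight (\<lambda>e. pmf (bernoulli_pmf (p e))) J F"
    if "F \<subseteq> J" for F
    unfolding emb[OF that] percolation_def weight_def using J
    by (subst measure_PiM_emb) (auto simp: pmf.rep_eq)
  have split: "{\<omega> \<in> configurations E. Q {e \<in> J. \<omega> e}} = (\<Union>F\<in>{F \<in> Pow J. Q F}. cyl F)"
    by (auto simp: cyl_def)
  have fin: "finite {F \<in> Pow J. Q F}" using J by simp
  show "{\<omega> \<in> configurations E. Q {e \<in> J. \<omega> e}} \<in> sets (percolation E p)"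
    unfolding split using fin meas by auto
  have "disjoint_family_on cyl {F \<in> Pow J. Q F}"
    by (auto simp: disjoint_family_on_def cyl_def)
  then show "measure (percolation E p) {\<omega> \<in> configurations E. Q {e \<in> J. \<omega> e}} =
      weight_of (\<lambda>e. pmf (bernoulli_pmf (p e))) J Q"
    unfolding split weight_of_def using fin meas prob
    by (subst perc.finite_measure_finite_Union) auto
qed

lemma finite_percolation_inequality:
  fixes E J :: "'v set set" and p :: "'v set \<Rightarrow> real" and a b c :: 'v
  assumes J: "J \<subseteq> E" "finite J" and card: "\<And>e. e \<in> E \<Longrightarrow> card e = 2"
  defines "t \<equiv> measure (percolation E p) {\<omega> \<in> configurations E. all_joined a b c {e \<in> J. \<omega> e}}"
    and "m \<equiv> measure (percolation E p) {\<omega> \<in> configurations E. some_joined a b c {e \<in> J. \<omega> e}}"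
  shows "t * (1 - m) \<le> m - t"
proof -
  interpret P: prob_space "percolation E p" by (rule prob_space_percolation)
  let ?h = "\<lambda>e. pmf (bernoulli_pmf (p e))"
  let ?S = "configurations E"
  note meas = measurable_finite_event[OF J] and wt = measure_finite_event[OF J, symmetric]
  have T: "t = weight_of ?h J (all_joined a b c)"
    unfolding t_def by (rule measure_finite_event[OF J])
  have N: "1 - m = weight_of ?h J (\<lambda>F. \<not> some_joined a b c F)"
  proof -
    have "weight_of ?h J (\<lambda>F. \<not> some_joined a b c F) = measure (percolation E p)
        (space (percolation E p) - {\<omega> \<in> ?S. some_joined a b c {e \<in> J. \<omega> e}})"
      unfolding wt space_percolation by (rule arg_cong[where f = "measure _"]) auto
    then show ?thesis by (simp add: m_def P.prob_compl[OF meas])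
  qed
  have X: "m - t = weight_of ?h J (\<lambda>F. some_joined a b c F \<and> \<not> all_joined a b c F)"
  proof -
    have "weight_of ?h J (\<lambda>F. some_joined a b c F \<and> \<not> all_joined a b c F) =
        measure (percolation E p) ({\<omega> \<in> ?S. some_joined a b c {e \<in> J. \<omega> e}} -
          {\<omega> \<in> ?S. all_joined a b c {e \<in> J. \<omega> e}})"
      unfolding wt by (rule arg_cong[where f = "measure _"]) auto
    also have "\<dots> = m - t"
      unfolding m_def t_def
      by (rule P.finite_measure_Diff[OF meas meas]) (auto simp: all_joined_def some_joined_def)
    finally show ?thesis by simp
  qed
  have one: "weight_of ?h J (\<lambda>_. True) = 1"
    unfolding wt using P.prob_space by (simp add: space_percolation)
  show ?thesis
    using joined_separated_weight_le[of J ?h a b c] J card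
    unfolding T[symmetric] N[symmetric] X[symmetric] one by auto
qed

section \<open>Exhausting an infinite graph\<close>

text \<open>Balls are finite by local finiteness, and their union is everything by connectedness.\<close>

lemma finite_edge_exhaustion:
  assumes simple: "simple_graph V E" and lf: "locally_finite_graph V E"
    and conn: "connected_graph V E" and a: "a \<in> V"
  obtains J :: "nat \<Rightarrow> 'v set set"
  where "\<And>n. finite (J n)" and "incseq J" and "(\<Union>n. J n) = E"
proof -
  define star where "star X = {e \<in> E. e \<inter> X \<noteq> {}}" for X
  define B where "B = rec_nat {a} (\<lambda>_ X. X \<union> \<Union> (star X))"
  have B0: "B 0 = {a}" and BS: "B (Suc n) = B n \<union> \<Union> (star (B n))" for n
    by (simp_all add: B_def)
  have finstar: "finite (star X)" if "finite X" "X \<subseteq> V" for X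
  proof -
    have "star X = (\<Union>v\<in>X. {e \<in> E. v \<in> e})" by (auto simp: star_def)
    then show ?thesis using that lf by (auto simp: locally_finite_graph_def)
  qed
  have fe: "finite e \<and> e \<subseteq> V" if "e \<in> E" for e
    using simple that by (auto simp: simple_graph_def card_2_iff)
  have B: "finite (B n) \<and> B n \<subseteq> V" for n
  proof (induction n)
    case 0
    then show ?case using a by (simp add: B0)
  next
    case (Suc n)
    then have "finite (star (B n))" using finstar by auto
    moreover have "\<forall>e\<in>star (B n). finite e \<and> e \<subseteq> V" using fe by (auto simp: star_def)
    ultimately show ?case using Suc by (auto simp: BS)
  qed
  have "incseq B" by (rule incseq_SucI) (auto simp: BS)
  have "component E a \<subseteq> (\<Union>n. B n)"
  proof (rule component_least)
    show "a \<in> (\<Union>n. B n)" using B0 by blast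
    fix x y assume "x \<in> (\<Union>n. B n)" and e: "{x, y} \<in> E"
    then obtain n where "x \<in> B n" by auto
    then have "y \<in> B (Suc n)" using e unfolding BS star_def by blast
    then show "y \<in> (\<Union>n. B n)" by blast
  qed
  then have V: "V \<subseteq> (\<Union>n. B n)" using conn a by (auto simp: connected_graph_def)
  show ?thesis
  proof
    show "finite (star (B n))" for n using finstar B by auto
    show "incseq (\<lambda>n. star (B n))"
      using \<open>incseq B\<close> unfolding incseq_def star_def by blast
    have "\<exists>n. e \<in> star (B n)" if "e \<in> E" for e
    proof -
      have "card e = 2" "e \<subseteq> V" using simple that by (auto simp: simple_graph_def)
      then obtain v where v: "v \<in> e" "v \<in> V" by (auto simp: card_2_iff)
      with V obtain n where "v \<in> B n" by blast
      with v that show ?thesis by (auto simp: star_def)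
    qed
    then show "(\<Union>n. star (B n)) = E" by (auto simp: star_def)
  qed
qed

text \<open>A connection uses finitely many edges, so it is present from some stage on.\<close>

lemma component_incseq_Union:
  assumes "incseq F"
  shows "component (\<Union>n. F n) v = (\<Union>n. component (F n) v)"
proof
  show "component (\<Union>n. F n) v \<subseteq> (\<Union>n. component (F n) v)"
  proof (rule component_least)
    show "v \<in> (\<Union>n. component (F n) v)" by (auto intro: component_refl)
    fix x y assume "x \<in> (\<Union>n. component (F n) v)" and "{x, y} \<in> (\<Union>n. F n)"
    then obtain i j where i: "x \<in> component (F i) v" and j: "{x, y} \<in> F j" by auto
    have "x \<in> component (F (max i j)) v"
      using i component_mono[of "F i" "F (max i j)"] assms by (auto simp: incseq_def)
    moreover have "{x, y} \<in> F (max i j)"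
      using j assms unfolding incseq_def by (meson max.cobounded2 subsetD)
    ultimately show "y \<in> (\<Union>n. component (F n) v)" by (auto intro: component_step)
  qed
  show "(\<Union>n. component (F n) v) \<subseteq> component (\<Union>n. F n) v"
    using component_mono[of "F _" "\<Union>n. F n"] by blast
qed

lemma all_joined_mono: "F \<subseteq> G \<Longrightarrow> all_joined a b c F \<Longrightarrow> all_joined a b c G"
  using component_mono[of F G] by (auto simp: all_joined_def)

lemma some_joined_mono: "F \<subseteq> G \<Longrightarrow> some_joined a b c F \<Longrightarrow> some_joined a b c G"
  using component_mono[of F G] by (fastforce simp: some_joined_def)

lemma all_joined_incseq_Union:
  assumes "incseq F"
  shows "all_joined a b c (\<Union>n. F n) \<longleftrightarrow> (\<exists>n. all_joined a b c (F n))"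
proof
  assume "all_joined a b c (\<Union>n. F n)"
  then obtain i j where ij: "b \<in> component (F i) a" "c \<in> component (F j) a"
    by (auto simp: all_joined_def component_incseq_Union[OF assms])
  have "F i \<subseteq> F (max i j)" "F j \<subseteq> F (max i j)" using assms by (auto simp: incseq_def)
  then have "all_joined a b c (F (max i j))"
    using ij component_mono[of _ "F (max i j)" a] by (auto simp: all_joined_def)
  then show "\<exists>n. all_joined a b c (F n)" ..
qed (auto intro: all_joined_mono[of "F _" "\<Union>n. F n"])

lemma some_joined_incseq_Union:
  "incseq F \<Longrightarrow> some_joined a b c (\<Union>n. F n) \<longleftrightarrow> (\<exists>n. some_joined a b c (F n))"
  by (auto simp: some_joined_def component_incseq_Union)

lemma
  fixes E :: "'v set set" and J :: "nat \<Rightarrow> 'v set set"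
  assumes J: "\<And>n. finite (J n)" "incseq J" "(\<Union>n. J n) = E"
    and mono: "\<And>F G. F \<subseteq> G \<Longrightarrow> Q F \<Longrightarrow> Q G"
    and cont: "\<And>F. incseq F \<Longrightarrow> Q (\<Union>n. F n) \<longleftrightarrow> (\<exists>n. Q (F n))"
  shows measurable_exhausted_event:
      "{\<omega> \<in> configurations E. Q {e \<in> E. \<omega> e}} \<in> sets (percolation E p)"
    and measure_exhausted_event:
      "(\<lambda>n. measure (percolation E p) {\<omega> \<in> configurations E. Q {e \<in> J n. \<omega> e}})
       \<longlonglongrightarrow> measure (percolation E p) {\<omega> \<in> configurations E. Q {e \<in> E. \<omega> e}}"
proof -
  interpret P: prob_space "percolation E p" by (rule prob_space_percolation)
  define C where "C n = {\<omega> \<in> configurations E. Q {e \<in> J n. \<omega> e}}" for n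
  have meas: "C n \<in> sets (percolation E p)" for n
    unfolding C_def by (rule measurable_finite_event) (use J in auto)
  have inc: "incseq (\<lambda>n. {e \<in> J n. \<omega> e})" for \<omega>
    using J(2) unfolding incseq_def by blast
  have "incseq C"
    by (auto simp: incseq_def C_def intro: mono[OF incseqD[OF inc]])
  have "{e \<in> E. \<omega> e} = (\<Union>n. {e \<in> J n. \<omega> e})" for \<omega>
    using J(3) by auto
  then have lim: "{\<omega> \<in> configurations E. Q {e \<in> E. \<omega> e}} = (\<Union>n. C n)"
    using cont[OF inc] by (auto simp: C_def)
  show "{\<omega> \<in> configurations E. Q {e \<in> E. \<omega> e}} \<in> sets (percolation E p)"
    unfolding lim using meas by auto
  show "(\<lambda>n. measure (percolation E p) {\<omega> \<in> configurations E. Q {e \<in> J n. \<omega> e}})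
       \<longlonglongrightarrow> measure (percolation E p) {\<omega> \<in> configurations E. Q {e \<in> E. \<omega> e}}"
    unfolding lim C_def[symmetric]
    using P.finite_Lim_measure_incseq[of C] meas \<open>incseq C\<close> by auto
qed

section \<open>The inequality for three vertices\<close>

lemma separated_Un_eq:
  "separated E a b \<union> separated E a c =
     configurations E - {\<omega> \<in> configurations E. all_joined a b c {e \<in> E. \<omega> e}}"
  "separated E a b \<union> separated E b c =
     configurations E - {\<omega> \<in> configurations E. all_joined a b c {e \<in> E. \<omega> e}}"
  "separated E a c \<union> separated E b c =
     configurations E - {\<omega> \<in> configurations E. all_joined a b c {e \<in> E. \<omega> e}}"
  unfolding separated_def cluster_def all_joined_def
  by (auto simp: component_eq_iff dest: component_sym component_trans)

lemma separated3_eq: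
  "separated3 E a b c =
     configurations E - {\<omega> \<in> configurations E. some_joined a b c {e \<in> E. \<omega> e}}"
  by (auto simp: separated3_def cluster_def some_joined_def component_eq_iff)

lemma sum_of_quotients_le:
  fixes s q :: real
  assumes "0 \<le> s" "2 * s \<le> q * (1 + q)" "0 < q" "q \<le> 1"
  shows "s\<^sup>2 / q + s\<^sup>2 / q \<le> s + q\<^sup>2"
proof -
  have "s * (2 * s) \<le> s * (q * (1 + q))"
    using assms by (intro mult_left_mono) auto
  moreover have "s * (q * q) \<le> q * (q * q)"
  proof (rule mult_right_mono)
    have "q * (1 + q) \<le> q * 2" using assms by (intro mult_left_mono) auto
    then show "s \<le> q" using assms by linarith
  qed simp
  ultimately have "2 * s\<^sup>2 \<le> (s + q\<^sup>2) * q"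
    by (simp add: power2_eq_square algebra_simps)
  then show ?thesis using \<open>0 < q\<close> by (simp add: divide_simps)
qed

theorem lemma1p2:
  fixes V :: "'v set" and E :: "'v set set" and p :: "'v set \<Rightarrow> real" and a b c :: 'v
  assumes "simple_graph V E" and "locally_finite_graph V E" and "connected_graph V E"
    and "\<And>e. e \<in> E \<Longrightarrow> 0 \<le> p e \<and> p e \<le> 1"
    and "a \<in> V" and "b \<in> V" and "c \<in> V"
    and "a \<noteq> b" and "a \<noteq> c" and "b \<noteq> c"
    and "measure (percolation E p) (separated E a b \<union> separated E b c) \<noteq> 0"
    and "measure (percolation E p) (separated E a c \<union> separated E b c) \<noteq> 0"
  shows "measure (percolation E p) (separated3 E a b c)
           + (measure (percolation E p) (separated E a b \<union> separated E a c))\<^sup>2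
         \<ge> (measure (percolation E p) (separated3 E a b c))\<^sup>2
             / measure (percolation E p) (separated E a b \<union> separated E b c)
           + (measure (percolation E p) (separated3 E a b c))\<^sup>2
             / measure (percolation E p) (separated E a c \<union> separated E b c)"
proof -
  interpret P: prob_space "percolation E p" by (rule prob_space_percolation)
  let ?ev = "\<lambda>Q J. {\<omega> \<in> configurations E. Q {e \<in> J. \<omega> e}}"
  let ?M = "measure (percolation E p)"
  define t where "t = ?M (?ev (all_joined a b c) E)"
  define m where "m = ?M (?ev (some_joined a b c) E)"
  obtain J :: "nat \<Rightarrow> 'v set set" where J: "\<And>n. finite (J n)" "incseq J" "(\<Union>n. J n) = E"
    by (rule finite_edge_exhaustion[OF assms(1-3) \<open>a \<in> V\<close>]) blast
  note all = all_joined_mono[of _ _ a b c] all_joined_incseq_Union[of _ a b c]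
  note some = some_joined_mono[of _ _ a b c] some_joined_incseq_Union[of _ a b c]
  have t_lim: "(\<lambda>n. ?M (?ev (all_joined a b c) (J n))) \<longlonglongrightarrow> t"
    unfolding t_def by (rule measure_exhausted_event[OF J all])
  have m_lim: "(\<lambda>n. ?M (?ev (some_joined a b c) (J n))) \<longlonglongrightarrow> m"
    unfolding m_def by (rule measure_exhausted_event[OF J some])
  have le: "t * (1 - m) \<le> m - t"
  proof (rule LIMSEQ_le)
    show "(\<lambda>n. ?M (?ev (all_joined a b c) (J n)) * (1 - ?M (?ev (some_joined a b c) (J n))))
        \<longlonglongrightarrow> t * (1 - m)"
      by (intro tendsto_intros t_lim m_lim)
    show "(\<lambda>n. ?M (?ev (some_joined a b c) (J n)) - ?M (?ev (all_joined a b c) (J n)))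
        \<longlonglongrightarrow> m - t"
      by (intro tendsto_intros t_lim m_lim)
    show "\<exists>N. \<forall>n\<ge>N. ?M (?ev (all_joined a b c) (J n)) * (1 - ?M (?ev (some_joined a b c) (J n)))
        \<le> ?M (?ev (some_joined a b c) (J n)) - ?M (?ev (all_joined a b c) (J n))"
      using J assms(1)
      by (intro exI allI impI finite_percolation_inequality) (auto simp: simple_graph_def)
  qed
  have q: "?M (configurations E - ?ev (all_joined a b c) E) = 1 - t"
    unfolding t_def using P.prob_compl[OF measurable_exhausted_event[OF J all]]
    by (simp add: space_percolation)
  have s: "?M (configurations E - ?ev (some_joined a b c) E) = 1 - m"
    unfolding m_def using P.prob_compl[OF measurable_exhausted_event[OF J some]]
    by (simp add: space_percolation)
  have t01: "0 \<le> t" "t \<le> 1" and m1: "m \<le> 1" by (simp_all add: t_def m_def)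
  have "1 - t \<noteq> 0" using assms(11) by (simp add: separated_Un_eq q)
  have "2 * (1 - m) \<le> (1 - t) * (1 + (1 - t))"
  proof -
    have "t * (m - t) \<le> 1 * (m - t)"
    proof (rule mult_right_mono[OF \<open>t \<le> 1\<close>])
      show "0 \<le> m - t" using le t01 m1 mult_nonneg_nonneg[of t "1 - m"] by linarith
    qed
    with le show ?thesis by (simp add: algebra_simps)
  qed
  then have "(1 - m)\<^sup>2 / (1 - t) + (1 - m)\<^sup>2 / (1 - t) \<le> (1 - m) + (1 - t)\<^sup>2"
    using t01 m1 \<open>1 - t \<noteq> 0\<close> by (intro sum_of_quotients_le) auto
  then show ?thesis
    unfolding separated_Un_eq separated3_eq q s .
qed

end
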